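(* Let $m$ be a complex number, $x$ an indeterminate, and let $D_m(n,x)=\sum_{k=0}^n W_m(n,k)x^k$ be the Dowling polynomials. Then, as formal power series in $z$, $$\sum_{n=0}^{\infty}D_m(n,x)z^n=\cfrac{1}{1-b_0z-\cfrac{\lambda_1z^2}{1-b_1z-\cfrac{\lambda_2z^2}{1-b_2z-\cfrac{\lambda_3z^2}{1-b_3z-\cdots}}}},$$ where $b_n=x+nm+1$ for $n\ge 0$ and $\lambda_n=nmx$ for $n\ge 1$. Consequently, the Hankel transform $h_n=\det\big(D_m(i+j,x)\big)_{0\le i,j\le n}$ of the sequence $(D_m(n,x))_{n\ge 0}$ is, for all $n\ge 0$, $$h_n=(mx)^{\binom{n+1}{2}}\prod_{k=0}^n k!.$$
   Context: The Whitney numbers of the second kind of Dowling lattices are $W_m(n,k)=\sum_{i=k}^n\binom{n}{i}m^{i-k}S(i,k)$ (with $0^0=1$), where $S(i,k)$ are the Stirling numbers of the second kind; for $m\ne 0$ this is equivalent to $\sum_{n\ge 0} W_m(n,k)\frac{z^n}{n!}=\frac{e^z}{m^k k!}(e^{mz}-1)^k$, and $W_0(n,k)=\binom{n}{k}$. The infinite continued fraction denotes the limit, in the $z$-adic topology on $\mathbb{C}[x][[z]]$, of its finite truncations. The Hankel transform of a sequence $(a_n)_{n\ge 0}$ is the sequence of determinants $h_n=\det(a_{i+j})_{0\le i,j\le n}$. *)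

theory Defs
  imports
    "HOL-Combinatorics.Stirling"
    "HOL-Computational_Algebra.Polynomial"
    "HOL-Computational_Algebra.Formal_Power_Series"
    "Jordan_Normal_Form.Determinant"
begin

definition dowling_whitney :: "complex \<Rightarrow> nat \<Rightarrow> nat \<Rightarrow> complex" where
  "dowling_whitney m n k =
     (\<Sum>i=k..n. of_nat (n choose i) * m ^ (i - k) * of_nat (Stirling i k))"

definition dowling_poly :: "complex \<Rightarrow> nat \<Rightarrow> complex poly" where
  "dowling_poly m n = (\<Sum>k=0..n. monom (dowling_whitney m n k) k)"

text \<open>
  The reciprocal of a power series with constant coefficient 1. The \<^const>\<open>inverse\<close> on power
  series needs an \<^const>\<open>inverse\<close> on the coefficients, which a polynomial ring does not have.
\<close>

definition fps_recip :: "'a::comm_ring_1 fps \<Rightarrow> 'a fps" where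
  "fps_recip f = fps_right_inverse f 1"

lemma fps_recip_right: "fps_nth f 0 = 1 \<Longrightarrow> f * fps_recip f = 1"
  unfolding fps_recip_def by (rule fps_right_inverse) simp

text \<open>
  \<open>jfrac_trunc b l N j\<close> is the finite continued fraction
  $1/(1 - b_j z - l_{j+1} z^2/(1 - b_{j+1} z - \cdots - l_{j+N} z^2/(1 - b_{j+N} z)))$.
  All denominators have constant coefficient 1. The value \<open>l 0\<close> is never used.
\<close>

fun jfrac_trunc ::
    "(nat \<Rightarrow> 'a::comm_ring_1) \<Rightarrow> (nat \<Rightarrow> 'a) \<Rightarrow> nat \<Rightarrow> nat \<Rightarrow> 'a fps" where
  "jfrac_trunc b l 0 j = fps_recip (1 - fps_const (b j) * fps_X)"
| "jfrac_trunc b l (Suc N) j =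
     fps_recip (1 - fps_const (b j) * fps_X
                  - fps_const (l (Suc j)) * fps_X ^ 2 * jfrac_trunc b l N (Suc j))"

text \<open>
  The metric on \<^typ>\<open>'a fps\<close> induces the adic topology with respect to \<^const>\<open>fps_X\<close>,
  with discrete coefficients.
\<close>

definition has_jfrac ::
    "'a::comm_ring_1 fps \<Rightarrow> (nat \<Rightarrow> 'a) \<Rightarrow> (nat \<Rightarrow> 'a) \<Rightarrow> bool" where
  "has_jfrac F b l \<longleftrightarrow> (\<lambda>N. jfrac_trunc b l N 0) \<longlonglongrightarrow> F"

definition hankel_transform :: "(nat \<Rightarrow> 'a::comm_ring_1) \<Rightarrow> nat \<Rightarrow> 'a" where
  "hankel_transform a n = det (mat (n + 1) (n + 1) (\<lambda>(i, j). a (i + j)))"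

end

theory Submission
  imports Defs
begin

text \<open>
  Let $A(n,k)$ be the total weight of the Motzkin paths from height $0$ to height $k$ in $n$ steps,
  with weights $1$, $b_k$, $\lambda_k$ for a rise, a level step at height $k$, a fall from height $k$.
  The generating functions $G_k$ of the columns satisfy
  $(1 - b_k z) G_k = z G_{k-1} + \lambda_{k+1} z G_{k+1}$ (with $1$ for $z G_{k-1}$ when $k = 0$);
  iterating this expands $G_0$ into the continued fraction. The tridiagonal recurrence is
  self-adjoint for the weights $\lambda_1 \cdots \lambda_k$, so the Hankel matrix of
  $A(n,0)$ factors as $L D L^T$ with $L = (A(i,k))$ unitriangular.

  For the Dowling polynomials, $A(n,k) = \sum_j W_m(n,j) \binom{j}{k} x^{j-k}$. This comes from
  the exponential generating function $e^z e^{xu} u^k / k!$ with $u = (e^{mz} - 1)/m$, whose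
  derivative gives the recurrence because $u' = 1 + mu$.
\<close>

section \<open>Weighted Motzkin paths and their continued fraction\<close>

fun motzkin_array :: "(nat \<Rightarrow> 'a::comm_ring_1) \<Rightarrow> (nat \<Rightarrow> 'a) \<Rightarrow> nat \<Rightarrow> nat \<Rightarrow> 'a" where
  "motzkin_array b l 0 k = (if k = 0 then 1 else 0)"
| "motzkin_array b l (Suc n) k =
     (if k = 0 then 0 else motzkin_array b l n (k - 1))
       + b k * motzkin_array b l n k + l (Suc k) * motzkin_array b l n (Suc k)"

lemma motzkin_array_eq_0: "n < k \<Longrightarrow> motzkin_array b l n k = 0"
  by (induction n arbitrary: k) auto

lemma motzkin_array_diag: "motzkin_array b l n n = 1"
  by (induction n) (auto simp: motzkin_array_eq_0)

definition motzkin_fps :: "(nat \<Rightarrow> 'a::comm_ring_1) \<Rightarrow> (nat \<Rightarrow> 'a) \<Rightarrow> nat \<Rightarrow> 'a fps" where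
  "motzkin_fps b l k = Abs_fps (\<lambda>n. motzkin_array b l n k)"

lemma motzkin_fps_rec:
  "(1 - fps_const (b k) * fps_X) * motzkin_fps b l k =
     (if k = 0 then 1 else fps_X * motzkin_fps b l (k - 1))
       + fps_X * fps_const (l (Suc k)) * motzkin_fps b l (Suc k)"
proof (rule fps_ext)
  fix n
  show "fps_nth ((1 - fps_const (b k) * fps_X) * motzkin_fps b l k) n =
     fps_nth ((if k = 0 then 1 else fps_X * motzkin_fps b l (k - 1))
       + fps_X * fps_const (l (Suc k)) * motzkin_fps b l (Suc k)) n"
    by (cases n) (auto simp: motzkin_fps_def algebra_simps mult.assoc)
qed

lemma fps_recip_left: "fps_nth f 0 = 1 \<Longrightarrow> fps_recip f * f = 1"
  by (simp add: fps_recip_right mult.commute)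

text \<open>The factor after the truncated fraction is the inhomogeneous term of
  \<open>motzkin_fps_rec\<close>. Unfolding one level of the fraction turns the error at height \<open>k\<close> into a
  multiple of \<open>fps_X\<close> times the error at height \<open>Suc k\<close>.\<close>

lemma motzkin_fps_approx:
  "fps_X ^ Suc N dvd motzkin_fps b l k
     - jfrac_trunc b l N k * (if k = 0 then 1 else fps_X * motzkin_fps b l (k - 1))"
proof (induction N arbitrary: k)
  case 0
  let ?q = "1 - fps_const (b k) * fps_X"
  let ?C = "jfrac_trunc b l 0 k"
  have C: "?C * ?q = 1"
    by (simp add: fps_recip_left)
  have "motzkin_fps b l k = ?C * (?q * motzkin_fps b l k)"
    by (simp only: mult.assoc[symmetric] C mult_1_left)
  then have "motzkin_fps b l k
      - ?C * (if k = 0 then 1 else fps_X * motzkin_fps b l (k - 1))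
      = fps_X * (?C * fps_const (l (Suc k)) * motzkin_fps b l (Suc k))"
    by (simp only: motzkin_fps_rec) (simp only: algebra_simps)
  then show ?case by simp
next
  case (Suc N)
  let ?C = "jfrac_trunc b l (Suc N) k"
  let ?C' = "jfrac_trunc b l N (Suc k)"
  let ?p = "1 - fps_const (b k) * fps_X"
  let ?q = "?p - fps_const (l (Suc k)) * fps_X ^ 2 * ?C'"
  \<comment> \<open>The error at height \<open>Suc k\<close>. One factor of \<open>fps_X ^ 2\<close>
    in \<open>?q\<close> enters its inhomogeneous term, the other stays outside.\<close>
  let ?R = "motzkin_fps b l (Suc k) - ?C' * (fps_X * motzkin_fps b l k)"
  have C: "?C * ?q = 1"
    by (simp add: fps_recip_left power2_eq_square mult.assoc)
  have "motzkin_fps b l k = ?C * (?q * motzkin_fps b l k)"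
    by (simp only: mult.assoc[symmetric] C mult_1_left)
  also have "?q * motzkin_fps b l k = ?p * motzkin_fps b l k
      - fps_const (l (Suc k)) * fps_X ^ 2 * ?C' * motzkin_fps b l k"
    by (simp only: left_diff_distrib)
  also have "\<dots> = (if k = 0 then 1 else fps_X * motzkin_fps b l (k - 1))
      + fps_X * fps_const (l (Suc k)) * ?R"
    by (simp only: motzkin_fps_rec power2_eq_square) (simp only: algebra_simps)
  finally have "motzkin_fps b l k
      - ?C * (if k = 0 then 1 else fps_X * motzkin_fps b l (k - 1))
      = (?C * fps_const (l (Suc k))) * (fps_X * ?R)"
    by (simp only: algebra_simps)
  moreover have "fps_X ^ Suc N dvd ?R"
    using Suc.IH[of "Suc k"] by simp
  ultimately show ?case
    by (simp only: power_Suc[of _ "Suc N"]) (intro dvd_mult mult_dvd_mono dvd_refl)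
qed

lemma fps_X_power_dvd_imp_nth_eq_0:
  fixes f :: "'a::comm_ring_1 fps"
  assumes "fps_X ^ N dvd f" "n < N"
  shows "fps_nth f n = 0"
  using assms by (auto simp: dvd_def fps_X_power_mult_nth)

theorem has_jfrac_motzkin: "has_jfrac (Abs_fps (\<lambda>n. motzkin_array b l n 0)) b l"
  unfolding has_jfrac_def
proof (rule tendsto_fpsI)
  fix n
  \<comment> \<open>At height 0 the inhomogeneous term is 1, so an error divisible by
    \<open>fps_X ^ Suc N\<close> leaves all coefficients up to index \<open>N\<close>
    correct.\<close>
  have "fps_nth (jfrac_trunc b l N 0) n = fps_nth (motzkin_fps b l 0) n" if "n \<le> N" for N
    using fps_X_power_dvd_imp_nth_eq_0[OF motzkin_fps_approx[of N b l 0], of n] that by simp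
  then show "\<forall>\<^sub>F N in sequentially. fps_nth (jfrac_trunc b l N 0) n
      = fps_nth (Abs_fps (\<lambda>n. motzkin_array b l n 0)) n"
    by (auto simp: eventually_sequentially motzkin_fps_def)
qed

section \<open>Hankel determinants of the zeroth column\<close>

text \<open>Cut a path of length \<open>i + j\<close> from 0 to 0 after \<open>i\<close> steps, at
  height \<open>k\<close>. Reversing the second piece turns falls into rises, which costs the
  product of the \<open>l t\<close>. The bound \<open>K\<close> cuts off no height reachable in
  \<open>i\<close> steps.\<close>

lemma motzkin_array_bilinear:
  assumes "i \<le> K"
  shows "(\<Sum>k\<le>K. motzkin_array b l i k * (\<Prod>t=1..k. l t) * motzkin_array b l j k)
           = motzkin_array b l (i + j) 0"
  using assms
proof (induction i arbitrary: j)
  case 0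
  show ?case by (simp add: if_distrib[of "\<lambda>x. x * _"] cong: if_cong)
next
  case (Suc i)
  let ?A = "motzkin_array b l"
  let ?D = "\<lambda>k. \<Prod>t=1..k. l t"
  have shift: "(\<Sum>k\<le>K. (if k = 0 then 0 else ?A p (k - 1)) * ?D k * ?A q k)
      = (\<Sum>k<K. ?D (Suc k) * ?A p k * ?A q (Suc k))" for p q
  proof (cases K)
    case (Suc K')
    then show ?thesis
      by (simp only: sum.atMost_Suc_shift lessThan_Suc_atMost) (simp add: mult_ac)
  qed simp
  \<comment> \<open>Swapping \<open>p\<close> and \<open>q\<close> exchanges the first and third
    sums, up to the summand \<open>k = K\<close> of the third.\<close>
  have expand: "(\<Sum>k\<le>K. ?A (Suc p) k * ?D k * ?A q k)
      = (\<Sum>k<K. ?D (Suc k) * ?A p k * ?A q (Suc k)) + (\<Sum>k\<le>K. b k * ?D k * ?A p k * ?A q k)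
        + (\<Sum>k\<le>K. ?D (Suc k) * ?A p (Suc k) * ?A q k)" for p q
    unfolding shift[symmetric] sum.distrib[symmetric]
    by (rule sum.cong) (simp_all add: algebra_simps)
  \<comment> \<open>For either order of \<open>i\<close> and \<open>j\<close>, the extra summand at
    \<open>k = K\<close> vanishes because \<open>i < K\<close>.\<close>
  have top: "?A i (Suc K) = 0" "?A i K = 0"
    using Suc.prems by (simp_all add: motzkin_array_eq_0)
  have last: "(\<Sum>k\<le>K. g k) = (\<Sum>k<K. g k) + g K" for g :: "nat \<Rightarrow> 'a"
    by (simp add: lessThan_Suc_atMost[symmetric])
  have "(\<Sum>k\<le>K. ?A (Suc i) k * ?D k * ?A j k) = (\<Sum>k\<le>K. ?A (Suc j) k * ?D k * ?A i k)"
    unfolding expand last[of "\<lambda>k. ?D (Suc k) * _ k * _ k"] top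
    by (simp add: mult_ac add_ac)
  also have "\<dots> = (\<Sum>k\<le>K. ?A i k * ?D k * ?A (Suc j) k)"
    by (simp add: mult_ac)
  also have "\<dots> = ?A (Suc i + j) 0"
    using Suc.IH[of "Suc j"] Suc.prems by (simp del: motzkin_array.simps)
  finally show ?case .
qed

theorem hankel_transform_motzkin:
  "hankel_transform (\<lambda>n. motzkin_array b l n 0) n = (\<Prod>k\<le>n. \<Prod>t=1..k. l t)"
proof -
  let ?A = "motzkin_array b l"
  let ?D = "\<lambda>k. \<Prod>t=1..k. l t"
  define L where "L = mat (n + 1) (n + 1) (\<lambda>(i, k). ?A i k)"
  \<comment> \<open>The diagonal factor is absorbed into the transpose, leaving a product of two
    triangular matrices.\<close>
  define U where "U = mat (n + 1) (n + 1) (\<lambda>(k, j). ?D k * ?A j k)"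
  have carr: "L \<in> carrier_mat (n + 1) (n + 1)" "U \<in> carrier_mat (n + 1) (n + 1)"
    by (simp_all add: L_def U_def)
  have "mat (n + 1) (n + 1) (\<lambda>(i, j). ?A (i + j) 0) = L * U"
  proof (rule eq_matI)
    fix i j assume ij: "i < dim_row (L * U)" "j < dim_col (L * U)"
    have "(L * U) $$ (i, j) = (\<Sum>k=0..<n + 1. ?A i k * (?D k * ?A j k))"
      using ij by (simp add: L_def U_def scalar_prod_def)
    also have "\<dots> = (\<Sum>k\<le>n. ?A i k * ?D k * ?A j k)"
      by (rule sum.cong) (auto simp: mult.assoc)
    also have "\<dots> = ?A (i + j) 0"
      using ij by (intro motzkin_array_bilinear) (simp add: L_def)
    finally show "mat (n + 1) (n + 1) (\<lambda>(i, j). ?A (i + j) 0) $$ (i, j) = (L * U) $$ (i, j)"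
      using ij by (simp add: L_def U_def)
  qed (simp_all add: L_def U_def)
  moreover have "det L = 1"
    using carr by (subst det_lower_triangular[where n = "n + 1"])
      (auto simp: L_def prod_list_diag_prod motzkin_array_eq_0 motzkin_array_diag)
  moreover have "det U = (\<Prod>k\<le>n. ?D k)"
  proof -
    have "det U = (\<Prod>k=0..<n + 1. ?D k)"
      using carr by (subst det_upper_triangular[where n = "n + 1"])
        (auto simp: U_def prod_list_diag_prod motzkin_array_eq_0 motzkin_array_diag
          intro!: upper_triangularI)
    then show ?thesis
      by (simp add: atLeast0LessThan lessThan_Suc_atMost)
  qed
  ultimately show ?thesis
    using carr by (simp add: hankel_transform_def det_mult)
qed

section \<open>Whitney numbers and Dowling polynomials\<close>

lemma dowling_whitney_atMost:
  "dowling_whitney m n k = (\<Sum>i\<le>n. of_nat (n choose i) * (m ^ (i - k) * of_nat (Stirling i k)))"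
  unfolding dowling_whitney_def
  by (rule sum.mono_neutral_cong_left) (auto simp: mult.assoc)

lemma dowling_whitney_0: "dowling_whitney m 0 k = (if k = 0 then 1 else 0)"
  by (cases k) (simp_all add: dowling_whitney_def)

lemma dowling_whitney_eq_0: "n < k \<Longrightarrow> dowling_whitney m n k = 0"
  by (simp add: dowling_whitney_def)

text \<open>The Whitney numbers are the binomial transform of m^(i-k) S(i,k), which inherits a
  recurrence with factor m k from the Stirling numbers; Pascal's rule adds the 1.\<close>

lemma dowling_whitney_Suc:
  "dowling_whitney m (Suc n) k =
     (if k = 0 then 0 else dowling_whitney m n (k - 1)) + (1 + m * of_nat k) * dowling_whitney m n k"
proof -
  define T where "T i k = m ^ (i - k) * of_nat (Stirling i k)" for i k
  have T_Suc: "T (Suc i) k = (if k = 0 then 0 else T i (k - 1)) + m * of_nat k * T i k" for i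
  proof (cases k)
    case (Suc k')
    show ?thesis
    \<comment> \<open>With truncated subtraction the power splits only for \<open>k' < i\<close>;
      otherwise S(i,k) = 0.\<close>
    proof (cases "k' < i")
      case True
      then have "m ^ (i - k') = m * m ^ (i - Suc k')"
        by (metis Suc_diff_Suc power_Suc)
      then show ?thesis using Suc by (simp add: T_def algebra_simps)
    next
      case False
      then show ?thesis using Suc by (simp add: T_def algebra_simps)
    qed
  qed (simp add: T_def)
  have W: "dowling_whitney m n k = (\<Sum>i\<le>n. of_nat (n choose i) * T i k)" for n k
    by (simp add: dowling_whitney_atMost T_def)
  have "dowling_whitney m (Suc n) k
      = T 0 k + (\<Sum>i\<le>n. of_nat (Suc n choose Suc i) * T (Suc i) k)"
    unfolding W by (subst sum.atMost_Suc_shift) simp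
  also have "\<dots> = (T 0 k + (\<Sum>i\<le>n. of_nat (n choose Suc i) * T (Suc i) k))
      + (\<Sum>i\<le>n. of_nat (n choose i) * T (Suc i) k)"
    by (simp add: algebra_simps sum.distrib)
  \<comment> \<open>\<open>T 0 k\<close> supplies the missing term at index 0, and the added term at
    \<open>Suc n\<close> has binomial coefficient 0.\<close>
  also have "T 0 k + (\<Sum>i\<le>n. of_nat (n choose Suc i) * T (Suc i) k)
      = (\<Sum>i\<le>Suc n. of_nat (n choose i) * T i k)"
    by (subst sum.atMost_Suc_shift) simp
  also have "\<dots> = dowling_whitney m n k"
    by (simp add: W)
  also have "(\<Sum>i\<le>n. of_nat (n choose i) * T (Suc i) k)
      = (if k = 0 then 0 else dowling_whitney m n (k - 1)) + m * of_nat k * dowling_whitney m n k"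
    unfolding T_Suc by (simp add: W algebra_simps sum.distrib sum_distrib_left)
  finally show ?thesis by (simp add: algebra_simps)
qed

text \<open>\<open>P j k\<close> is the coefficient of y^k in f = (x+y)^j. The terms with
  \<open>m\<close> express (x+y) f' = j f, the others multiplication by x + y + 1. This trades the
  Whitney recurrence in \<open>j\<close> for the Motzkin recurrence in \<open>k\<close>.\<close>

lemma binomial_monom_rec:
  fixes m x :: "'a::comm_ring_1"
  defines "P \<equiv> \<lambda>j k. of_nat (j choose k) * x ^ (j - k)"
  shows "P (Suc j) k + (1 + m * of_nat j) * P j k =
    (if k = 0 then 0 else P j (k - 1)) + (x + of_nat k * m + 1) * P j k
      + of_nat (Suc k) * m * x * P j (Suc k)"
proof -
  \<comment> \<open>The difference is taken in the ring, so the identity also covers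
    \<open>k > j\<close>, where both binomials vanish.\<close>
  have down: "of_nat (Suc k) * x * P j (Suc k) = (of_nat j - of_nat k) * P j k"
  proof (cases "k < j")
    case True
    have "Suc k * (j choose Suc k) = (j - k) * (j choose k)"
      by (metis binomial_absorb_comp mult.commute binomial_absorption)
    then have "of_nat (Suc k) * of_nat (j choose Suc k)
        = (of_nat j - of_nat k) * (of_nat (j choose k) :: 'a)"
      using True by (metis of_nat_diff of_nat_mult less_imp_le)
    moreover have "x * x ^ (j - Suc k) = x ^ (j - k)"
      using True by (metis Suc_diff_Suc power_Suc)
    ultimately show ?thesis
      unfolding P_def by (metis (no_types, lifting) mult.assoc mult.left_commute)
  next
    case False
    then show ?thesis by (cases "j = k") (auto simp: P_def binomial_eq_0)
  qed
  have up: "P (Suc j) k = (if k = 0 then 0 else P j (k - 1)) + x * P j k"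
  proof (cases "k \<le> j")
    case True
    then have "x ^ (Suc j - k) = x * x ^ (j - k)"
      by (simp add: Suc_diff_le)
    then show ?thesis
      by (cases k) (simp_all add: P_def algebra_simps)
  next
    case False
    then show ?thesis by (cases k) (auto simp: P_def binomial_eq_0)
  qed
  have "of_nat (Suc k) * m * x * P j (Suc k) = m * ((of_nat j - of_nat k) * P j k)"
    using down by (simp add: mult_ac)
  then show ?thesis
    unfolding up by (simp add: algebra_simps)
qed

text \<open>The induction needs all columns. For \<open>x\<close> the indeterminate, column
  \<open>k\<close> is the k-th derivative of the Dowling polynomial divided by k!, and column 0 is
  the polynomial itself.\<close>

lemma dowling_motzkin_array:
  fixes m :: complex and x :: "complex poly"
  shows "motzkin_array (\<lambda>n. x + of_nat n * [:m:] + 1) (\<lambda>n. of_nat n * [:m:] * x) n k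
    = (\<Sum>j\<le>n. [:dowling_whitney m n j:] * (of_nat (j choose k) * x ^ (j - k)))"
proof (induction n arbitrary: k)
  case 0
  show ?case by (simp add: dowling_whitney_0 one_pCons)
next
  case (Suc n)
  define P where "P j k = of_nat (j choose k) * x ^ (j - k)" for j k
  define w where "w n j = [:dowling_whitney m n j:]" for n j
  let ?A = "motzkin_array (\<lambda>n. x + of_nat n * [:m:] + 1) (\<lambda>n. of_nat n * [:m:] * x)"
  have IH: "?A n k = (\<Sum>j\<le>n. w n j * P j k)" for k
    unfolding P_def w_def by (rule Suc.IH)
  have w_Suc: "w (Suc n) j = (if j = 0 then 0 else w n (j - 1)) + (1 + [:m:] * of_nat j) * w n j" for j
    by (simp add: w_def dowling_whitney_Suc one_pCons of_nat_poly)
  \<comment> \<open>This lets the sum coming from the factor 1 + m j stop at \<open>n\<close>, the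
    range of the shifted sum.\<close>
  have w_0: "w n (Suc n) = 0"
    by (simp add: w_def dowling_whitney_eq_0)
  have "(\<Sum>j\<le>Suc n. w (Suc n) j * P j k)
      = (\<Sum>j\<le>Suc n. (if j = 0 then 0 else w n (j - 1)) * P j k)
        + (\<Sum>j\<le>Suc n. (1 + [:m:] * of_nat j) * w n j * P j k)"
    unfolding w_Suc sum.distrib[symmetric] by (simp only: distrib_right)
  also have "(\<Sum>j\<le>Suc n. (if j = 0 then 0 else w n (j - 1)) * P j k) = (\<Sum>j\<le>n. w n j * P (Suc j) k)"
    by (subst sum.atMost_Suc_shift) simp
  also have "(\<Sum>j\<le>Suc n. (1 + [:m:] * of_nat j) * w n j * P j k)
      = (\<Sum>j\<le>n. w n j * ((1 + [:m:] * of_nat j) * P j k))"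
    by (simp only: sum.atMost_Suc w_0) (simp add: mult_ac)
  also have "(\<Sum>j\<le>n. w n j * P (Suc j) k) + \<dots>
      = (\<Sum>j\<le>n. w n j * (P (Suc j) k + (1 + [:m:] * of_nat j) * P j k))"
    by (simp only: distrib_left sum.distrib)
  also have "\<dots> = (\<Sum>j\<le>n. w n j * ((if k = 0 then 0 else P j (k - 1))
      + (x + of_nat k * [:m:] + 1) * P j k + of_nat (Suc k) * [:m:] * x * P j (Suc k)))"
    unfolding P_def by (simp only: binomial_monom_rec)
  also have "\<dots> = (if k = 0 then 0 else ?A n (k - 1))
      + (x + of_nat k * [:m:] + 1) * ?A n k + of_nat (Suc k) * [:m:] * x * ?A n (Suc k)"
    unfolding IH sum_distrib_left
    by (simp only: distrib_left[of "w n _"] sum.distrib if_distrib[of "\<lambda>y. _ * y"])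
      (simp add: mult_ac)
  also have "\<dots> = ?A (Suc n) k"
    by (simp only: motzkin_array.simps)
  finally show ?case
    unfolding P_def w_def by (rule sym)
qed

lemma dowling_poly_motzkin:
  "dowling_poly m n = motzkin_array (\<lambda>n. [:0, 1:] + of_nat n * [:m:] + 1)
     (\<lambda>n. of_nat n * [:m:] * [:0, 1:]) n 0"
  unfolding dowling_motzkin_array dowling_poly_def atLeast0AtMost
  by (simp add: monom_altdef)

lemma prod_prod_of_nat_mult:
  fixes y :: "'a::{comm_semiring_1, semiring_char_0}"
  shows "(\<Prod>k\<le>n. \<Prod>t=1..k. of_nat t * y) = y ^ ((n + 1) choose 2) * (\<Prod>k=0..n. fact k)"
proof -
  have "(\<Prod>t=1..k. of_nat t * y) = y ^ k * fact k" for k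
    by (simp add: prod.distrib fact_prod mult.commute)
  then have "(\<Prod>k\<le>n. \<Prod>t=1..k. of_nat t * y) = y ^ (\<Sum>k\<le>n. k) * (\<Prod>k\<le>n. fact k)"
    by (simp add: prod.distrib power_sum)
  also have "(\<Sum>k\<le>n. k) = (n + 1) choose 2"
    by (simp add: atMost_atLeast0 gauss_sum_nat choose_two mult.commute)
  finally show ?thesis by (simp add: atMost_atLeast0)
qed

theorem mainTheorem5:
  fixes m :: complex and x :: "complex poly"
  defines "x \<equiv> [:0, 1:]"
  shows "has_jfrac (Abs_fps (\<lambda>n. dowling_poly m n))
           (\<lambda>n. x + of_nat n * [:m:] + 1) (\<lambda>n. of_nat n * [:m:] * x)
       \<and> (\<forall>n. hankel_transform (\<lambda>n. dowling_poly m n) n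
                 = ([:m:] * x) ^ ((n + 1) choose 2) * (\<Prod>k=0..n. fact k))"
  unfolding x_def dowling_poly_motzkin hankel_transform_motzkin
  by (intro conjI allI has_jfrac_motzkin) (simp only: mult.assoc prod_prod_of_nat_mult)

end
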